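(* Let $a,b,c$ be positive real numbers with $b>1$, and define $\theta_{a,b,c}(x)=\sqrt[x]{a\,\zeta(x+b)\,\Gamma(x+c)}$. If $a\,\zeta(b)\,\Gamma(c)\leq 1$, then the reciprocal $1/\theta_{a,b,c}(x)$ is logarithmically completely monotonic on $(1,\infty)$.
   Context: $\zeta(x)=\sum_{n\geq 1}n^{-x}$ is the Riemann zeta function (real $x>1$) and $\Gamma$ is the Euler Gamma function. A positive function $f$ is logarithmically completely monotonic on an interval $I$ if it is infinitely differentiable on $I$ and $(-1)^n[\log f(x)]^{(n)}\geq 0$ for all $x\in I$ and all integers $n\geq 1$. *)

theory Defs
  imports "HOL-Analysis.Analysis"
begin

definition zeta :: "real \<Rightarrow> real" where
  "zeta x = (\<Sum>n. real (Suc n) powr (- x))"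

definition theta :: "real \<Rightarrow> real \<Rightarrow> real \<Rightarrow> real \<Rightarrow> real" where
  "theta a b c x = (a * zeta (x + b) * Gamma (x + c)) powr (1 / x)"

(* Derivatives are taken within I, so that they are one-sided at an endpoint belonging to I
   and depend only on the values of the function on I. I is meant to be an interval with more
   than one point; for open I this agrees on I with
   (deriv ^^ n) f. *)
definition higher_deriv_on :: "real set \<Rightarrow> nat \<Rightarrow> (real \<Rightarrow> real) \<Rightarrow> real \<Rightarrow> real" where
  "higher_deriv_on I n = (\<lambda>f x. vector_derivative f (at x within I)) ^^ n"

definition infinitely_differentiable_on :: "(real \<Rightarrow> real) \<Rightarrow> real set \<Rightarrow> bool" where
  "infinitely_differentiable_on f I \<longleftrightarrow> (\<forall>n. higher_deriv_on I n f differentiable_on I)"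

definition log_completely_monotonic_on :: "(real \<Rightarrow> real) \<Rightarrow> real set \<Rightarrow> bool" where
  "log_completely_monotonic_on f I \<longleftrightarrow>
     (\<forall>x\<in>I. f x > 0) \<and> infinitely_differentiable_on f I \<and>
     (\<forall>n\<ge>1. \<forall>x\<in>I. (- 1) ^ n * higher_deriv_on I n (\<lambda>t. ln (f t)) x \<ge> 0)"

end

theory Submission
  imports Defs "HOL-Number_Theory.Prime_Powers"
begin

text \<open>
  Put \<open>F x = ln (a \<zeta>(x + b) \<Gamma>(x + c))\<close>, so that \<open>ln (1 / \<theta> x) = - F x / x\<close> and \<open>F 0 \<le> 0\<close>.
  The signs \<open>(-1)^k F\<^sup>(\<^sup>k\<^sup>) \<ge> 0\<close> for \<open>k \<ge> 2\<close> hold separately for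
  \<open>ln \<Gamma>\<close> (polygamma functions) and for \<open>ln \<zeta>\<close>, because \<open>\<zeta>' / \<zeta>\<close> is the Dirichlet series
  with coefficients \<open>- \<Lambda>(n) \<le> 0\<close>. The \<open>n\<close>-th derivative of \<open>- F x / x\<close> equals
  \<open>(-1)^(n+1) n! T\<^sub>n(x) / x^(n+1)\<close>, where \<open>T\<^sub>n(x)\<close> is the Taylor polynomial of \<open>F\<close> of degree \<open>n\<close>
  centred at \<open>x\<close> and evaluated at \<open>0\<close>. Since \<open>T\<^sub>n'(x) = (-x)^n F\<^sup>(\<^sup>n\<^sup>+\<^sup>1\<^sup>)(x) / n! \<le> 0\<close>
  for \<open>n \<ge> 1\<close>, we get \<open>T\<^sub>n(x) \<le> T\<^sub>n(0) = F 0 \<le> 0\<close>.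
\<close>

section \<open>Iterated derivatives\<close>

lemma higher_deriv_on_Suc:
  "higher_deriv_on S (Suc n) f x = vector_derivative (higher_deriv_on S n f) (at x within S)"
  by (simp add: higher_deriv_on_def)

lemma vector_derivative_eq_of_eq_on:
  fixes f :: "real \<Rightarrow> real"
  assumes "open S" "x \<in> S" "\<And>y. y \<in> S \<Longrightarrow> f y = g y" "(g has_real_derivative D) (at x)"
  shows "vector_derivative f (at x within S) = D"
proof -
  have "(f has_real_derivative D) (at x)"
    by (rule has_field_derivative_transform_within_open[OF assms(4,1,2)]) (use assms(3) in auto)
  then have "(f has_vector_derivative D) (at x)"
    by (simp add: has_real_derivative_iff_has_vector_derivative)
  then show ?thesis
    by (simp only: at_within_open[OF assms(2,1)] vector_derivative_at)
qed

text \<open>Reduces iterated derivatives within an open set to an explicit chain of ordinary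
  derivatives; applied below with \<open>g\<close> the logarithm of
  \<open>1 / theta a b c\<close>.\<close>

lemma higher_deriv_on_eq:
  fixes f :: "nat \<Rightarrow> real \<Rightarrow> real"
  assumes "open S" and deriv: "\<And>n x. x \<in> S \<Longrightarrow> (f n has_real_derivative f (Suc n) x) (at x)"
    and "\<And>x. x \<in> S \<Longrightarrow> g x = f 0 x" and "x \<in> S"
  shows "higher_deriv_on S n g x = f n x"
  using \<open>x \<in> S\<close>
proof (induction n arbitrary: x)
  case 0
  then show ?case using assms(3) by (simp add: higher_deriv_on_def)
next
  case (Suc n)
  show ?case
    unfolding higher_deriv_on_Suc
    by (rule vector_derivative_eq_of_eq_on[OF \<open>open S\<close> Suc.prems Suc.IH deriv[OF Suc.prems]])
qed

text \<open>Asking only for the existence of successive derivatives lets closure under sums,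
  products and \<open>exp\<close> go by induction, with no formula for the \<open>n\<close>-th
  derivative.\<close>

fun differentiable_times_on :: "nat \<Rightarrow> (real \<Rightarrow> real) \<Rightarrow> real set \<Rightarrow> bool" where
  "differentiable_times_on 0 f S \<longleftrightarrow> True"
| "differentiable_times_on (Suc n) f S \<longleftrightarrow>
     (\<exists>f'. (\<forall>x\<in>S. (f has_real_derivative f' x) (at x)) \<and> differentiable_times_on n f' S)"

lemma differentiable_times_on_SucI:
  assumes "\<And>x. x \<in> S \<Longrightarrow> (f has_real_derivative f' x) (at x)" "differentiable_times_on n f' S"
  shows "differentiable_times_on (Suc n) f S"
  using assms by auto

lemma differentiable_times_on_SucE:
  assumes "differentiable_times_on (Suc n) f S"
  obtains f' where "\<And>x. x \<in> S \<Longrightarrow> (f has_real_derivative f' x) (at x)" "differentiable_times_on n f' S"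
  using assms by auto

lemma differentiable_times_on_pred:
  "differentiable_times_on (Suc n) f S \<Longrightarrow> differentiable_times_on n f S"
proof (induction n arbitrary: f)
  case (Suc n)
  obtain f' where f': "\<And>x. x \<in> S \<Longrightarrow> (f has_real_derivative f' x) (at x)"
      "differentiable_times_on (Suc n) f' S"
    using Suc.prems by (rule differentiable_times_on_SucE) blast
  show ?case by (rule differentiable_times_on_SucI[OF f'(1) Suc.IH[OF f'(2)]])
qed simp

lemma differentiable_times_on_add:
  assumes "differentiable_times_on n f S" "differentiable_times_on n g S"
  shows "differentiable_times_on n (\<lambda>x. f x + g x) S"
  using assms
proof (induction n arbitrary: f g)
  case (Suc n)
  obtain f' where f': "\<And>x. x \<in> S \<Longrightarrow> (f has_real_derivative f' x) (at x)" "differentiable_times_on n f' S"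
    using Suc.prems(1) by (rule differentiable_times_on_SucE) blast
  obtain g' where g': "\<And>x. x \<in> S \<Longrightarrow> (g has_real_derivative g' x) (at x)" "differentiable_times_on n g' S"
    using Suc.prems(2) by (rule differentiable_times_on_SucE) blast
  show ?case
    by (rule differentiable_times_on_SucI[where f' = "\<lambda>x. f' x + g' x"])
      (auto intro!: DERIV_add Suc.IH f' g')
qed simp

lemma differentiable_times_on_mult:
  assumes "differentiable_times_on n f S" "differentiable_times_on n g S"
  shows "differentiable_times_on n (\<lambda>x. f x * g x) S"
  using assms
proof (induction n arbitrary: f g)
  case (Suc n)
  obtain f' where f': "\<And>x. x \<in> S \<Longrightarrow> (f has_real_derivative f' x) (at x)" "differentiable_times_on n f' S"
    using Suc.prems(1) by (rule differentiable_times_on_SucE) blast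
  obtain g' where g': "\<And>x. x \<in> S \<Longrightarrow> (g has_real_derivative g' x) (at x)" "differentiable_times_on n g' S"
    using Suc.prems(2) by (rule differentiable_times_on_SucE) blast
  show ?case
    by (rule differentiable_times_on_SucI[where f' = "\<lambda>x. f' x * g x + g' x * f x"])
      (auto intro!: DERIV_mult differentiable_times_on_add Suc.IH f' g'
         Suc.prems[THEN differentiable_times_on_pred])
qed simp

text \<open>The derivative \<open>exp (f x) * f' x\<close> contains \<open>exp (f x)\<close> again,
  but now only \<open>n\<close> orders are required of it, so the induction hypothesis and the
  product rule suffice.\<close>

lemma differentiable_times_on_exp:
  assumes "differentiable_times_on n f S"
  shows "differentiable_times_on n (\<lambda>x. exp (f x)) S"
  using assms
proof (induction n)
  case (Suc n)
  obtain f' where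
    f': "\<And>x. x \<in> S \<Longrightarrow> (f has_real_derivative f' x) (at x)" "differentiable_times_on n f' S"
    using Suc.prems by (rule differentiable_times_on_SucE) blast
  show ?case
    by (rule differentiable_times_on_SucI[where f' = "\<lambda>x. exp (f x) * f' x"])
      (auto intro!: DERIV_fun_exp differentiable_times_on_mult Suc.IH f'
         Suc.prems[THEN differentiable_times_on_pred])
qed simp

lemma differentiable_times_on_sequence:
  assumes "\<And>n x. x \<in> S \<Longrightarrow> (f n has_real_derivative f (Suc n) x) (at x)"
  shows "differentiable_times_on n (f k) S"
proof (induction n arbitrary: k)
  case (Suc n)
  show ?case
    by (rule differentiable_times_on_SucI[OF assms Suc.IH])
qed simp

text \<open>The surplus \<open>m\<close> makes the induction work: each further derivative uses up
  one order of it. Smoothness needs the case \<open>m = 1\<close>.\<close>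

lemma differentiable_times_on_higher_deriv_on:
  assumes "open S" "differentiable_times_on (n + m) f S"
  shows "\<exists>g. (\<forall>x\<in>S. higher_deriv_on S n f x = g x) \<and> differentiable_times_on m g S"
  using assms(2)
proof (induction n arbitrary: m)
  case 0
  then show ?case by (auto simp: higher_deriv_on_def)
next
  case (Suc n)
  have "differentiable_times_on (n + Suc m) f S"
    using Suc.prems by simp
  then obtain g where g: "\<And>x. x \<in> S \<Longrightarrow> higher_deriv_on S n f x = g x"
      and g_Suc: "differentiable_times_on (Suc m) g S"
    using Suc.IH by blast
  from g_Suc obtain g' where g': "\<And>x. x \<in> S \<Longrightarrow> (g has_real_derivative g' x) (at x)"
      "differentiable_times_on m g' S"
    by (rule differentiable_times_on_SucE) blast
  have "higher_deriv_on S (Suc n) f x = g' x" if "x \<in> S" for x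
    unfolding higher_deriv_on_Suc
    by (rule vector_derivative_eq_of_eq_on[OF \<open>open S\<close> that g g'(1)[OF that]])
  with g'(2) show ?case by blast
qed

lemma infinitely_differentiable_onI:
  assumes "open S" "\<And>n. differentiable_times_on n f S"
  shows "infinitely_differentiable_on f S"
  unfolding infinitely_differentiable_on_def differentiable_on_def
proof (intro allI ballI)
  fix n x assume x: "x \<in> S"
  from differentiable_times_on_higher_deriv_on[OF \<open>open S\<close> assms(2), of n 1] obtain g g' where
    g: "\<And>x. x \<in> S \<Longrightarrow> higher_deriv_on S n f x = g x"
      "\<And>x. x \<in> S \<Longrightarrow> (g has_real_derivative g' x) (at x)"
    by auto
  have "(higher_deriv_on S n f has_real_derivative g' x) (at x)"
    by (rule has_field_derivative_transform_within_open[OF g(2)[OF x] \<open>open S\<close> x]) (use g(1) in auto)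
  then show "higher_deriv_on S n f differentiable at x within S"
    unfolding real_differentiable_def by (blast intro: has_field_derivative_at_within)
qed

section \<open>Quotients \<open>F x / x\<close>\<close>

text \<open>The argument \<open>x\<close> is the moving centre of the expansion, whence the powers
  of \<open>0 - x\<close>; \<open>F k\<close> stands for the \<open>k\<close>-th derivative of
  \<open>F 0\<close>.\<close>

definition taylor_at_zero :: "(nat \<Rightarrow> real \<Rightarrow> real) \<Rightarrow> nat \<Rightarrow> real \<Rightarrow> real" where
  "taylor_at_zero F n x = (\<Sum>k\<le>n. (- x) ^ k / fact k * F k x)"

lemma taylor_at_zero_0: "taylor_at_zero F n 0 = F 0 0"
  by (simp add: taylor_at_zero_def sum.atMost_shift)

text \<open>The product rule gives two pieces per summand, and they telescope: only the piece with
  the highest derivative survives.\<close>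

lemma taylor_at_zero_deriv:
  assumes "\<And>k. (F k has_real_derivative F (Suc k) x) (at x)"
  shows "(taylor_at_zero F n has_real_derivative (- x) ^ n / fact n * F (Suc n) x) (at x)"
proof (induction n)
  case 0
  then show ?case using assms[of 0] by (simp add: taylor_at_zero_def)
next
  case (Suc n)
  have "((\<lambda>x. (- x) ^ Suc n / fact (Suc n)) has_real_derivative
      - (real (Suc n) * (- x) ^ n / fact (Suc n))) (at x)"
    by (rule derivative_eq_intros refl | simp)+
  also have "- (real (Suc n) * (- x) ^ n / fact (Suc n)) = - ((- x) ^ n / fact n)"
    by (simp add: divide_simps)
  finally have "((\<lambda>x. taylor_at_zero F n x + (- x) ^ Suc n / fact (Suc n) * F (Suc n) x)
      has_real_derivative (- x) ^ n / fact n * F (Suc n) x +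
       (- ((- x) ^ n / fact n) * F (Suc n) x + F (Suc (Suc n)) x * ((- x) ^ Suc n / fact (Suc n)))) (at x)"
    by (intro DERIV_add Suc.IH DERIV_mult assms)
  moreover have "taylor_at_zero F (Suc n) =
      (\<lambda>x. taylor_at_zero F n x + (- x) ^ Suc n / fact (Suc n) * F (Suc n) x)"
    by (simp add: taylor_at_zero_def fun_eq_iff)
  ultimately show ?case by (simp add: algebra_simps)
qed

text \<open>This is what the Leibniz rule gives for the product of \<open>- F 0 x\<close> and
  \<open>1 / x\<close>, with \<open>fact n / x ^ Suc n\<close> factored out.\<close>

definition neg_quotient_deriv :: "(nat \<Rightarrow> real \<Rightarrow> real) \<Rightarrow> nat \<Rightarrow> real \<Rightarrow> real" where
  "neg_quotient_deriv F n x = (- 1) ^ Suc n * fact n * taylor_at_zero F n x / x ^ Suc n"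

lemma neg_quotient_deriv_0: "neg_quotient_deriv F 0 x = - F 0 x / x"
  by (simp add: neg_quotient_deriv_def taylor_at_zero_def)

lemma neg_quotient_deriv_deriv:
  assumes "x \<noteq> 0" "\<And>k. (F k has_real_derivative F (Suc k) x) (at x)"
  shows "(neg_quotient_deriv F n has_real_derivative neg_quotient_deriv F (Suc n) x) (at x)"
proof -
  define T where "T = taylor_at_zero F n x"
  have "(neg_quotient_deriv F n has_real_derivative
     ((- 1) ^ Suc n * fact n * ((- x) ^ n / fact n * F (Suc n) x) * x ^ Suc n
       - (- 1) ^ Suc n * fact n * T * (real (Suc n) * x ^ n)) / (x ^ Suc n * x ^ Suc n)) (at x)"
    unfolding neg_quotient_deriv_def T_def using assms(1)
    by (intro DERIV_divide DERIV_cmult taylor_at_zero_deriv assms(2) DERIV_cong[OF DERIV_pow])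
      simp_all
  also have "((- 1) ^ Suc n * fact n * ((- x) ^ n / fact n * F (Suc n) x) * x ^ Suc n
       - (- 1) ^ Suc n * fact n * T * (real (Suc n) * x ^ n)) / (x ^ Suc n * x ^ Suc n)
     = (- 1) ^ Suc (Suc n) * fact (Suc n) * (T + (- x) ^ Suc n / fact (Suc n) * F (Suc n) x) /
        x ^ Suc (Suc n)"
  proof -
    \<comment> \<open>Sign, factorial and power are replaced by free variables, so that a purely
      rational identity remains.\<close>
    have "(- s * N * (s * p / N * f) * (x * p) - - s * N * T * (m * p)) / (x * p * (x * p))
        = s * (m * N) * (T + - x * (s * p) / (m * N) * f) / (x * (x * p))"
      if "N \<noteq> 0" "m \<noteq> 0" "p \<noteq> 0" for s N p f m :: real
      using that assms(1) by (simp add: field_simps)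
    from this[of "fact n" "real (Suc n)" "x ^ n" "(- 1) ^ n" "F (Suc n) x"] show ?thesis
      using assms(1) by (simp only: power_minus[of x] power_Suc fact_Suc) simp
  qed
  also have "\<dots> = neg_quotient_deriv F (Suc n) x"
    by (simp add: neg_quotient_deriv_def taylor_at_zero_def T_def)
  finally show ?thesis .
qed

lemma neg_quotient_deriv_sign:
  assumes deriv: "\<And>k x. x \<ge> 0 \<Longrightarrow> (F k has_real_derivative F (Suc k) x) (at x)"
    and sign: "\<And>k x. k \<ge> 2 \<Longrightarrow> x \<ge> 0 \<Longrightarrow> (- 1) ^ k * F k x \<ge> 0"
    and "F 0 0 \<le> 0" "x > 0" "n \<ge> 1"
  shows "(- 1) ^ n * neg_quotient_deriv F n x \<ge> 0"
proof -
  have "taylor_at_zero F n x \<le> taylor_at_zero F n 0"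
  proof (rule DERIV_nonpos_imp_nonincreasing[where f = "taylor_at_zero F n"])
    fix y :: real assume y: "0 \<le> y" "y \<le> x"
    have "(- y) ^ n * F (Suc n) y = - (y ^ n * ((- 1) ^ Suc n * F (Suc n) y))"
      by (simp add: power_minus[of y])
    \<comment> \<open>From \<open>n \<ge> 1\<close> the order \<open>Suc n\<close> is at least 2,
      the range where \<open>sign\<close> applies.\<close>
    moreover have "y ^ n * ((- 1) ^ Suc n * F (Suc n) y) \<ge> 0"
      using y \<open>n \<ge> 1\<close> by (intro mult_nonneg_nonneg sign) auto
    ultimately have "(- y) ^ n * F (Suc n) y / fact n \<le> 0"
      by (intro divide_nonpos_pos fact_gt_zero) linarith
    then have "(- y) ^ n / fact n * F (Suc n) y \<le> 0"
      by simp
    then show "\<exists>D. (taylor_at_zero F n has_real_derivative D) (at y) \<and> D \<le> 0"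
      using taylor_at_zero_deriv[of F y n, OF deriv[OF y(1)]] by blast
  qed (use \<open>x > 0\<close> in simp)
  then have "taylor_at_zero F n x \<le> 0"
    using \<open>F 0 0 \<le> 0\<close> by (simp add: taylor_at_zero_0)
  moreover have "(- 1) ^ n * neg_quotient_deriv F n x = - (fact n * taylor_at_zero F n x / x ^ Suc n)"
    by (simp add: neg_quotient_deriv_def mult.assoc del: fact_Suc flip: times_divide_eq_right)
  ultimately show ?thesis
    using \<open>x > 0\<close> by (simp add: divide_nonpos_pos mult_nonneg_nonpos)
qed

section \<open>Dirichlet series\<close>

text \<open>The term \<open>n = 0\<close> vanishes because \<open>0 powr s = 0\<close>.\<close>
definition dirichlet_series :: "(nat \<Rightarrow> real) \<Rightarrow> real \<Rightarrow> real" where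
  "dirichlet_series a s = (\<Sum>n. a n * real n powr (- s))"

text \<open>Says that the abscissa of absolute convergence is at most \<open>\<sigma>\<close>.
  Excluding \<open>\<sigma>\<close> itself makes the property stable under termwise
  differentiation.\<close>

definition abs_conv_beyond :: "real \<Rightarrow> (nat \<Rightarrow> real) \<Rightarrow> bool" where
  "abs_conv_beyond \<sigma> a \<longleftrightarrow> (\<forall>s>\<sigma>. summable (\<lambda>n. \<bar>a n\<bar> * real n powr (- s)))"

lemma abs_conv_beyond_summable:
  assumes "abs_conv_beyond \<sigma> a" "s > \<sigma>"
  shows "summable (\<lambda>n. a n * real n powr (- s))"
  by (rule summable_rabs_cancel) (use assms in \<open>simp add: abs_conv_beyond_def abs_mult\<close>)

lemma abs_conv_beyond_ln:
  assumes "abs_conv_beyond \<sigma> a"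
  shows "abs_conv_beyond \<sigma> (\<lambda>n. - ln (real n) * a n)"
  unfolding abs_conv_beyond_def
proof (intro allI impI)
  fix s :: real assume "s > \<sigma>"
  \<comment> \<open>Half of the gap absorbs the logarithm through
    \<open>ln n \<le> n powr d / d\<close>; the other half keeps \<open>s - d\<close> beyond
    \<open>\<sigma>\<close>.\<close>
  define d where "d = (s - \<sigma>) / 2"
  have d: "d > 0" "s - d > \<sigma>" using \<open>s > \<sigma>\<close> by (auto simp: d_def field_simps)
  have "summable (\<lambda>n. (\<bar>a n\<bar> * real n powr (- (s - d))) / d)"
    using assms d by (intro summable_divide) (simp only: abs_conv_beyond_def)
  then show "summable (\<lambda>n. \<bar>- ln (real n) * a n\<bar> * real n powr (- s))"
  proof (rule summable_comparison_test')
    fix n :: nat assume "n \<ge> 0"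
    show "norm (\<bar>- ln (real n) * a n\<bar> * real n powr (- s)) \<le> \<bar>a n\<bar> * real n powr (- (s - d)) / d"
    proof (cases "n = 0")
      case False
      then have "ln (real n) \<ge> 0" "ln (real n) \<le> real n powr d / d"
        using d by (auto intro: ln_powr_bound)
      then have "\<bar>a n\<bar> * real n powr (- s) * \<bar>ln (real n)\<bar> \<le> \<bar>a n\<bar> * real n powr (- s) * (real n powr d / d)"
        by (intro mult_left_mono) auto
      also have "\<dots> = \<bar>a n\<bar> * real n powr (- (s - d)) / d"
        by (simp add: powr_add[symmetric] mult.assoc)
      finally show ?thesis by (simp add: abs_mult mult_ac)
    qed simp
  qed
qed

lemma dirichlet_series_deriv:
  assumes conv: "abs_conv_beyond \<sigma> a" and "s > \<sigma>"
  shows "(dirichlet_series a has_real_derivative dirichlet_series (\<lambda>n. - ln (real n) * a n) s) (at s)"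
proof -
  \<comment> \<open>With \<open>t\<close> strictly between \<open>\<sigma>\<close> and
    \<open>s\<close>, the point \<open>s\<close> is interior to \<open>{t<..}\<close>, where the
    differentiated series is dominated by its absolute values at \<open>t\<close>.\<close>
  define t where "t = (s + \<sigma>) / 2"
  have t: "t > \<sigma>" "s > t" using \<open>s > \<sigma>\<close> by (auto simp: t_def field_simps)
  let ?f' = "\<lambda>n x. - ln (real n) * a n * real n powr (- x)"
  have "uniformly_convergent_on {t<..} (\<lambda>n x. \<Sum>i<n. ?f' i x)"
  proof (rule Weierstrass_m_test')
    show "norm (?f' n x) \<le> \<bar>- ln (real n) * a n\<bar> * real n powr (- t)" if "x \<in> {t<..}" for n x
    proof (cases "n = 0")
      case False
      then have "real n powr (- x) \<le> real n powr (- t)"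
        using that by (intro powr_mono) auto
      then show ?thesis by (simp add: abs_mult mult_left_mono)
    qed simp
    show "summable (\<lambda>n. \<bar>- ln (real n) * a n\<bar> * real n powr (- t))"
      using abs_conv_beyond_ln[OF conv] t by (simp add: abs_conv_beyond_def)
  qed
  moreover have "((\<lambda>x. a n * real n powr (- x)) has_real_derivative ?f' n x) (at x within {t<..})" for n x
  proof (cases "n = 0")
    case False
    then have "((\<lambda>x. real n powr (- x)) has_real_derivative
        real n powr (- x) * (- 1 * ln (real n) + 0 * (- x) / real n)) (at x)"
      by (intro DERIV_powr) (auto intro!: derivative_eq_intros)
    from DERIV_cmult[OF this, of "a n"] show ?thesis
      by (auto intro!: has_field_derivative_at_within simp: algebra_simps)
  qed simp
  ultimately show ?thesis
    unfolding dirichlet_series_def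
    by (intro has_field_derivative_series'(2)[where S = "{t<..}" and ?x0.0 = s])
      (use t abs_conv_beyond_summable[OF conv \<open>s > \<sigma>\<close>] in \<open>auto simp: interior_open\<close>)
qed

lemma abs_conv_beyond_ln_power:
  assumes "abs_conv_beyond \<sigma> a"
  shows "abs_conv_beyond \<sigma> (\<lambda>n. (- ln (real n)) ^ k * a n)"
proof (induction k)
  case (Suc k)
  from abs_conv_beyond_ln[OF this] show ?case by (simp add: mult.assoc)
qed (use assms in simp)

lemma dirichlet_series_ln_power_deriv:
  assumes "abs_conv_beyond \<sigma> a" "s > \<sigma>"
  shows "(dirichlet_series (\<lambda>n. (- ln (real n)) ^ k * a n) has_real_derivative
           dirichlet_series (\<lambda>n. (- ln (real n)) ^ Suc k * a n) s) (at s)"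
  using dirichlet_series_deriv[OF abs_conv_beyond_ln_power[OF assms(1)] assms(2), of k]
  by (simp add: mult.assoc)

text \<open>Holds term by term: the sign \<open>(- 1) ^ k\<close> turns \<open>(- ln n) ^ k\<close>
  into \<open>ln n ^ k\<close>, which is nonnegative for \<open>n \<ge> 1\<close>.\<close>

lemma dirichlet_series_ln_power_sign:
  assumes "abs_conv_beyond \<sigma> a" "s > \<sigma>" "\<And>n. a n \<ge> 0"
  shows "(- 1) ^ k * dirichlet_series (\<lambda>n. (- ln (real n)) ^ k * a n) s \<ge> 0"
proof -
  have summable: "summable (\<lambda>n. (- ln (real n)) ^ k * a n * real n powr (- s))"
    by (rule abs_conv_beyond_summable[OF abs_conv_beyond_ln_power[OF assms(1)] assms(2)])
  have "(- 1) ^ k * dirichlet_series (\<lambda>n. (- ln (real n)) ^ k * a n) s =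
      (\<Sum>n. (- 1) ^ k * ((- ln (real n)) ^ k * a n * real n powr (- s)))"
    unfolding dirichlet_series_def by (rule suminf_mult[symmetric, OF summable])
  also have "\<dots> \<ge> 0"
  proof (rule suminf_nonneg[OF summable_mult[OF summable]])
    fix n :: nat
    have "(- 1) ^ k * ((- ln (real n)) ^ k * a n * real n powr (- s)) =
        ln (real n) ^ k * a n * real n powr (- s)"
      by (simp flip: power_mult_distrib mult.assoc)
    also have "\<dots> \<ge> 0"
      using assms(3) by (cases "n = 0") auto
    finally show "(- 1) ^ k * ((- ln (real n)) ^ k * a n * real n powr (- s)) \<ge> 0" .
  qed
  finally show ?thesis .
qed

text \<open>Passes to unordered sums, in which the product of two series can be regrouped.\<close>

lemma dirichlet_series_has_sum:
  assumes "abs_conv_beyond \<sigma> a" "s > \<sigma>"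
  shows "((\<lambda>n. a n * real n powr (- s)) has_sum dirichlet_series a s) {1..}"
proof -
  have "((\<lambda>n. a n * real n powr (- s)) has_sum dirichlet_series a s) UNIV"
    unfolding dirichlet_series_def
    using assms abs_conv_beyond_summable[OF assms]
    by (intro norm_summable_imp_has_sum) (auto simp: abs_conv_beyond_def abs_mult)
  also have "?this \<longleftrightarrow> ?thesis"
    by (rule has_sum_cong_neutral) (auto simp: not_le)
  finally show ?thesis .
qed

section \<open>The derivatives of \<open>ln \<zeta>\<close> and \<open>ln \<Gamma>\<close>\<close>

lemma abs_conv_beyond_1: "abs_conv_beyond 1 (\<lambda>_. 1)"
  by (simp add: abs_conv_beyond_def summable_real_powr_iff)

text \<open>Since \<open>mangoldt n \<le> ln n\<close> for \<open>n \<ge> 1\<close>, the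
  differentiated zeta series is a majorant.\<close>

lemma abs_conv_beyond_mangoldt: "abs_conv_beyond 1 mangoldt"
  unfolding abs_conv_beyond_def
proof (intro allI impI)
  fix s :: real assume "s > 1"
  have "summable (\<lambda>n. \<bar>- ln (real n) * 1\<bar> * real n powr (- s))"
    using abs_conv_beyond_ln[OF abs_conv_beyond_1] \<open>s > 1\<close> by (simp add: abs_conv_beyond_def)
  then show "summable (\<lambda>n. \<bar>mangoldt n\<bar> * real n powr (- s))"
  proof (rule summable_comparison_test')
    fix n :: nat
    show "norm (\<bar>mangoldt n\<bar> * real n powr (- s)) \<le> \<bar>- ln (real n) * 1\<bar> * real n powr (- s)"
      using mangoldt_le[of n] mangoldt_nonneg[of n] by (cases "n = 0") (auto intro!: mult_right_mono)
  qed
qed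

lemma zeta_eq_dirichlet_series:
  assumes "s > 1"
  shows "zeta s = dirichlet_series (\<lambda>_. 1) s"
proof -
  have "summable (\<lambda>n. 1 * real n powr (- s))"
    using abs_conv_beyond_summable[OF abs_conv_beyond_1 assms] .
  from suminf_split_head[OF this] show ?thesis
    by (simp add: zeta_def dirichlet_series_def del: of_nat_Suc)
qed

lemma zeta_pos:
  assumes "s > 1"
  shows "zeta s > 0"
  unfolding zeta_def
proof (rule suminf_pos)
  have "summable (\<lambda>n. real n powr (- s))"
    using assms by (simp add: summable_real_powr_iff)
  then show "summable (\<lambda>n. real (Suc n) powr (- s))"
    by (subst summable_Suc_iff)
qed simp

text \<open>The Dirichlet convolution of \<open>mangoldt\<close> with the constant 1 is
  \<open>ln\<close>. The right-hand side is minus the termwise derivative of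
  \<open>zeta\<close>.\<close>

lemma zeta_mult_mangoldt_series:
  assumes s: "s > 1"
  shows "zeta s * dirichlet_series mangoldt s = - dirichlet_series (\<lambda>n. - ln (real n) * 1) s"
proof -
  let ?p = "\<lambda>n. real n powr (- s)"
  let ?A = "dirichlet_series mangoldt s"
  define f where "f = (\<lambda>(d, e). (mangoldt d * ?p d) * (1 * ?p e))"
  have inner: "((\<lambda>e. f (d, e)) has_sum (mangoldt d * ?p d * zeta s)) {1..}" for d
    unfolding f_def prod.case zeta_eq_dirichlet_series[OF s]
    by (intro has_sum_cmult_right dirichlet_series_has_sum[OF abs_conv_beyond_1 s])
  have outer: "((\<lambda>d. mangoldt d * ?p d * zeta s) has_sum (?A * zeta s)) {1..}"
    by (intro has_sum_cmult_left dirichlet_series_has_sum[OF abs_conv_beyond_mangoldt s])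
  have div: "d \<ge> 1 \<and> n div d \<ge> 1" if "d dvd n" "n \<ge> 1" for d n :: nat
    using that by (auto simp: Suc_le_eq dvd_imp_le div_greater_zero_iff intro: dvd_pos_nat)
  \<comment> \<open>All terms are nonnegative, so summability of the iterated sum gives that of the
    double sum.\<close>
  have "f summable_on Sigma {1..} (\<lambda>_. {1..})"
    by (rule summable_on_SigmaI[OF inner has_sum_imp_summable[OF outer]])
      (auto simp: f_def mangoldt_nonneg)
  then have "(f has_sum (?A * zeta s)) (Sigma {1..} (\<lambda>_. {1..}))"
    by (rule has_sum_SigmaI[OF inner outer])
  \<comment> \<open>Groups the pairs \<open>(d, e)\<close> by their product
    \<open>n = d * e\<close>; the inner index then runs over the divisors of
    \<open>n\<close>.\<close>
  also have "?this \<longleftrightarrow>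
      ((\<lambda>(n, d). mangoldt d * ?p n) has_sum (?A * zeta s)) (Sigma {1..} (\<lambda>n. {d. d dvd n}))"
    by (rule has_sum_reindex_bij_witness[where j = "\<lambda>(d, e). (d * e, d)" and i = "\<lambda>(n, d). (d, n div d)"])
      (simp_all add: f_def powr_mult div split: prod.splits, auto dest: div)
  finally have "((\<lambda>n. ln (real n) * ?p n) has_sum (?A * zeta s)) {1..}"
  proof (rule has_sum_SigmaD)
    fix n :: nat assume "n \<in> {1..}"
    then have n: "n \<noteq> 0" by simp
    have "(\<Sum>d | d dvd n. mangoldt d * ?p n) = ln (real n) * ?p n"
      using mangoldt_sum[OF n, where ?'a = real] by (simp flip: sum_distrib_right)
    then show "((\<lambda>d. (\<lambda>(n, d). mangoldt d * ?p n) (n, d)) has_sum (ln (real n) * ?p n)) {d. d dvd n}"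
      using n by (intro has_sum_finiteI) auto
  qed
  from has_sum_cmult_right[OF this, of "- 1"]
  have "((\<lambda>n. - ln (real n) * 1 * ?p n) has_sum (- (?A * zeta s))) {1..}"
    by simp
  then have "- (?A * zeta s) = dirichlet_series (\<lambda>n. - ln (real n) * 1) s"
    by (rule has_sum_unique[OF _ dirichlet_series_has_sum[OF abs_conv_beyond_ln[OF abs_conv_beyond_1] s]])
  then show ?thesis by (simp add: mult.commute)
qed

lemma zeta_deriv:
  assumes "s > 1"
  shows "(zeta has_real_derivative - (zeta s * dirichlet_series mangoldt s)) (at s)"
proof -
  have "(dirichlet_series (\<lambda>_. 1) has_real_derivative dirichlet_series (\<lambda>n. - ln (real n) * 1) s) (at s)"
    by (rule dirichlet_series_deriv[OF abs_conv_beyond_1 assms])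
  then have "(zeta has_real_derivative dirichlet_series (\<lambda>n. - ln (real n) * 1) s) (at s)"
    by (rule has_field_derivative_transform_within_open[where S = "{1<..}"])
      (use assms in \<open>auto simp: zeta_eq_dirichlet_series\<close>)
  then show ?thesis by (simp add: zeta_mult_mangoldt_series[OF assms])
qed

text \<open>The logarithmic derivative of \<open>zeta\<close> is minus the series of
  \<open>mangoldt\<close>; order \<open>Suc k\<close> is therefore its \<open>k\<close>-th termwise
  derivative.\<close>

fun ln_zeta_deriv :: "nat \<Rightarrow> real \<Rightarrow> real" where
  "ln_zeta_deriv 0 = (\<lambda>s. ln (zeta s))"
| "ln_zeta_deriv (Suc k) = (\<lambda>s. - dirichlet_series (\<lambda>n. (- ln (real n)) ^ k * mangoldt n) s)"

lemma ln_zeta_deriv_deriv: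
  assumes "s > 1"
  shows "(ln_zeta_deriv k has_real_derivative ln_zeta_deriv (Suc k) s) (at s)"
proof (cases k)
  case 0
  have "((\<lambda>s. ln (zeta s)) has_real_derivative - dirichlet_series mangoldt s) (at s)"
    using zeta_pos[OF assms] by (auto intro!: derivative_eq_intros zeta_deriv[OF assms])
  then show ?thesis by (simp add: 0)
next
  case (Suc j)
  have "((\<lambda>s. - dirichlet_series (\<lambda>n. (- ln (real n)) ^ j * mangoldt n) s) has_real_derivative
      - dirichlet_series (\<lambda>n. (- ln (real n)) ^ Suc j * mangoldt n) s) (at s)"
    by (intro DERIV_minus dirichlet_series_ln_power_deriv[OF abs_conv_beyond_mangoldt assms])
  then show ?thesis by (simp add: Suc)
qed

lemma ln_zeta_deriv_sign:
  assumes "s > 1" "k \<ge> 1"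
  shows "(- 1) ^ k * ln_zeta_deriv k s \<ge> 0"
proof -
  obtain j where "k = Suc j" using \<open>k \<ge> 1\<close> by (cases k) auto
  then show ?thesis
    using dirichlet_series_ln_power_sign[OF abs_conv_beyond_mangoldt assms(1) mangoldt_nonneg, of j]
    by simp
qed

fun ln_Gamma_deriv :: "nat \<Rightarrow> real \<Rightarrow> real" where
  "ln_Gamma_deriv 0 = ln_Gamma"
| "ln_Gamma_deriv (Suc k) = Polygamma k"

lemma ln_Gamma_deriv_deriv:
  assumes "x > 0"
  shows "(ln_Gamma_deriv k has_real_derivative ln_Gamma_deriv (Suc k) x) (at x)"
proof -
  have "x \<notin> \<int>\<^sub>\<le>\<^sub>0" using assms by (auto elim!: nonpos_Ints_cases)
  then show ?thesis
    using assms has_field_derivative_ln_Gamma_real[of x] has_field_derivative_Polygamma[of x]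
    by (cases k) auto
qed

text \<open>On the positive axis \<open>Polygamma j\<close> is positive for odd \<open>j\<close> and
  negative for even \<open>j > 0\<close>. Starting at \<open>k = 2\<close> excludes the digamma
  function, which changes sign.\<close>

lemma ln_Gamma_deriv_sign:
  assumes "x > 0" "k \<ge> 2"
  shows "(- 1) ^ k * ln_Gamma_deriv k x \<ge> 0"
proof -
  obtain j where k: "k = Suc j" "j > 0" using \<open>k \<ge> 2\<close> by (cases k) auto
  have "x \<notin> \<int>\<^sub>\<le>\<^sub>0" using assms by (auto elim!: nonpos_Ints_cases)
  then show ?thesis
    using Polygamma_real_odd_pos[of x j] Polygamma_real_even_neg[of x j] assms(1) k
    by (cases "even j") auto
qed

section \<open>The combined logarithm and the conclusion\<close>

definition ln_zeta_Gamma_deriv :: "real \<Rightarrow> real \<Rightarrow> real \<Rightarrow> nat \<Rightarrow> real \<Rightarrow> real" where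
  "ln_zeta_Gamma_deriv a b c k x =
     (if k = 0 then ln a else 0) + ln_zeta_deriv k (x + b) + ln_Gamma_deriv k (x + c)"

lemma ln_zeta_Gamma_deriv_0:
  assumes "a > 0" "x + b > 1" "x + c > 0"
  shows "ln_zeta_Gamma_deriv a b c 0 x = ln (a * zeta (x + b) * Gamma (x + c))"
proof -
  have "ln (a * zeta (x + b) * Gamma (x + c)) = ln a + ln (zeta (x + b)) + ln (Gamma (x + c))"
    using assms zeta_pos[OF assms(2)] Gamma_real_pos[OF assms(3)] by (simp add: ln_mult_pos)
  then show ?thesis using assms(3) by (simp add: ln_zeta_Gamma_deriv_def ln_Gamma_real_pos)
qed

lemma ln_zeta_Gamma_deriv_deriv:
  assumes "x + b > 1" "x + c > 0"
  shows "(ln_zeta_Gamma_deriv a b c k has_real_derivative ln_zeta_Gamma_deriv a b c (Suc k) x) (at x)"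
proof -
  have "((\<lambda>x. (if k = 0 then ln a else 0) + ln_zeta_deriv k (x + b) + ln_Gamma_deriv k (x + c))
      has_real_derivative 0 + ln_zeta_deriv (Suc k) (x + b) + ln_Gamma_deriv (Suc k) (x + c)) (at x)"
    by (intro DERIV_add DERIV_const DERIV_shift[THEN iffD1] ln_zeta_deriv_deriv ln_Gamma_deriv_deriv assms)
  then show ?thesis by (simp add: ln_zeta_Gamma_deriv_def[abs_def])
qed

lemma ln_zeta_Gamma_deriv_sign:
  assumes "x + b > 1" "x + c > 0" "k \<ge> 2"
  shows "(- 1) ^ k * ln_zeta_Gamma_deriv a b c k x \<ge> 0"
  using ln_zeta_deriv_sign[of "x + b" k] ln_Gamma_deriv_sign[of "x + c" k] assms
  by (simp add: ln_zeta_Gamma_deriv_def distrib_left)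

theorem theorem4p6:
  fixes a b c :: real
  assumes "a > 0" and "b > 1" and "c > 0"
    and "a * zeta b * Gamma c \<le> 1"
  shows "log_completely_monotonic_on (\<lambda>x. 1 / theta a b c x) {1<..}"
proof -
  let ?F = "ln_zeta_Gamma_deriv a b c"
  let ?G = "neg_quotient_deriv ?F"
  \<comment> \<open>The range must reach down to 0, where the Taylor polynomials are compared;
    \<open>b > 1\<close> and \<open>c > 0\<close> allow this.\<close>
  have F_deriv: "(?F k has_real_derivative ?F (Suc k) x) (at x)" if "x \<ge> 0" for k x
    using that assms by (intro ln_zeta_Gamma_deriv_deriv) auto
  have G_deriv: "(?G n has_real_derivative ?G (Suc n) x) (at x)" if "x \<in> {1<..}" for n x
    using that by (intro neg_quotient_deriv_deriv F_deriv) auto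
  \<comment> \<open>Positivity turns the bound \<open>a * zeta b * Gamma c \<le> 1\<close> into a
    nonpositive logarithm, which is \<open>?F 0 0\<close>.\<close>
  have "0 < a * zeta b * Gamma c"
    using assms zeta_pos[OF \<open>b > 1\<close>] by (simp add: Gamma_real_pos)
  then have "?F 0 0 \<le> 0"
    using ln_zeta_Gamma_deriv_0[of a 0 b c] assms by simp
  then have sign: "(- 1) ^ n * ?G n x \<ge> 0" if "n \<ge> 1" "x \<in> {1<..}" for n x
    using that assms by (intro neg_quotient_deriv_sign F_deriv ln_zeta_Gamma_deriv_sign) auto
  have theta_eq: "1 / theta a b c x = exp (?G 0 x)" if "x \<in> {1<..}" for x
  proof -
    have "a * zeta (x + b) * Gamma (x + c) > 0"
      using that assms zeta_pos[of "x + b"] Gamma_real_pos[of "x + c"] by simp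
    \<comment> \<open>Settles the case distinction on a zero base in \<open>powr_def\<close>; the
      product is kept whole by removing \<open>mult_eq_0_iff\<close>.\<close>
    then have "a * zeta (x + b) * Gamma (x + c) \<noteq> 0"
      by (rule less_imp_neq[THEN not_sym])
    then show ?thesis
      using that assms
      by (simp add: theta_def neg_quotient_deriv_0 ln_zeta_Gamma_deriv_0 powr_def exp_minus inverse_eq_divide
          del: mult_eq_0_iff)
  qed
  have smooth: "infinitely_differentiable_on (\<lambda>x. 1 / theta a b c x) {1<..}"
  proof (rule infinitely_differentiable_onI)
    fix n
    \<comment> \<open>One extra order is taken so that only the first derivative must be carried
      over along \<open>theta_eq\<close>: the same \<open>f'\<close> serves both functions.\<close>
    have "differentiable_times_on (Suc n) (\<lambda>x. exp (?G 0 x)) {1<..}"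
      by (intro differentiable_times_on_exp differentiable_times_on_sequence G_deriv)
    then obtain f' where f': "\<And>x. x \<in> {1<..} \<Longrightarrow> ((\<lambda>x. exp (?G 0 x)) has_real_derivative f' x) (at x)"
        "differentiable_times_on n f' {1<..}"
      by auto
    have "((\<lambda>x. 1 / theta a b c x) has_real_derivative f' x) (at x)" if "x \<in> {1<..}" for x
      by (rule has_field_derivative_transform_within_open[OF f'(1)[OF that] _ that])
        (use theta_eq in auto)
    with f'(2) have "differentiable_times_on (Suc n) (\<lambda>x. 1 / theta a b c x) {1<..}"
      by (blast intro: differentiable_times_on_SucI)
    then show "differentiable_times_on n (\<lambda>x. 1 / theta a b c x) {1<..}"
      by (rule differentiable_times_on_pred)
  qed simp
  \<comment> \<open>By \<open>theta_eq\<close> the logarithm equals \<open>?G 0\<close> on the open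
    half-line, so the chain \<open>?G\<close> gives all its derivatives.\<close>
  have "higher_deriv_on {1<..} n (\<lambda>t. ln (1 / theta a b c t)) x = ?G n x" if "x \<in> {1<..}" for n x
    by (rule higher_deriv_on_eq[where f = ?G]) (use that in \<open>simp_all add: theta_eq G_deriv\<close>)
  then show ?thesis
    using smooth sign theta_eq by (auto simp: log_completely_monotonic_on_def)
qed

end
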